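(* The modified system IX.B(2) depending on two parameters $a_1,a_2\in\mathbb{C}$ is $$\begin{cases} (y_{92\mathrm m})'=-\dfrac{a_2}{a_1}\,(y_{92\mathrm m})^2+6\,\dfrac{a_1}{a_2}\big(a_1\,z_{92\mathrm m}+2q\big),\\[2ex] (z_{92\mathrm m})'=\dfrac{a_2}{a_1}\,y_{92\mathrm m}\,z_{92\mathrm m},\end{cases}$$ with the function $q$ being a $\mathrm{P}_{\mathrm I}$ transcendent.
   Context: The independent variable is $x\in\mathbb{C}$, $'=d/dx$, and $y_{92\mathrm m},z_{92\mathrm m},q$ are functions of $x$. The first Painlevé equation is $(\mathrm{P}_{\mathrm I})\colon y''=6y^2+x$; a $\mathrm{P}_{\mathrm I}$ transcendent is a solution of $(\mathrm{P}_{\mathrm I})$. System V is $y_5'=z_5$, $z_5'=6y_5^2+x$, so that $y_5$ satisfies $(\mathrm{P}_{\mathrm I})$. The (unmodified) system IX.B(2) is $y_{92}'=z_{92}-y_{92}^2+12q$, $z_{92}'=y_{92}z_{92}$; it is obtained from system V by the re-scaled blow-up at the point $(y_5,z_5)=(q,q')$ of the orbit of system V, in the chart $(U,V)$ given by $y_5=\frac16UV+q$, $z_5=\frac16V+q'$, followed by the change of variables $(U,V)\mapsto(y_{92}=U^{-1},\,z_{92}=UV)$. "Modified system IX.B(2)" is the name of the system obtained in the same way when this blow-up-like transformation is generalised by introducing two arbitrary constants $a_1,a_2$ in place of the two factors $\frac16$, i.e. $y_5=a_1UV+q$, $z_5=a_2V+q'$, followed by $(U,V)\mapsto(y_{92\mathrm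 m}=U^{-1},\,z_{92\mathrm m}=UV)$. *)

theory Defs
  imports "HOL-Complex_Analysis.Complex_Analysis"
begin

definition PI_transcendent_on :: "complex set \<Rightarrow> (complex \<Rightarrow> complex) \<Rightarrow> bool" where
  "PI_transcendent_on S q \<longleftrightarrow>
     q holomorphic_on S \<and> (\<forall>x\<in>S. deriv (deriv q) x = 6 * (q x)\<^sup>2 + x)"

text \<open>
  A system of two first order equations \<open>u' = f(x,u,v)\<close>, \<open>v' = g(x,u,v)\<close> is represented by its
  right-hand side \<open>x \<mapsto> ((u,v) \<mapsto> (f(x,u,v), g(x,u,v)))\<close>.
\<close>

type_synonym ode_system = "complex \<Rightarrow> complex \<times> complex \<Rightarrow> complex \<times> complex"

definition satisfies_at ::
    "ode_system \<Rightarrow> complex \<Rightarrow> (complex \<Rightarrow> complex) \<Rightarrow> (complex \<Rightarrow> complex) \<Rightarrow> bool" where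
  "satisfies_at F x u v \<longleftrightarrow>
     (u has_field_derivative fst (F x (u x, v x))) (at x) \<and>
     (v has_field_derivative snd (F x (u x, v x))) (at x)"

definition system_V :: ode_system where
  "system_V x = (\<lambda>(y, z). (z, 6 * y\<^sup>2 + x))"

text \<open>
  Two systems correspond under an \<open>x\<close>-dependent substitution \<open>\<Phi>\<close> if, as long as the point
  \<open>(u,v)\<close> lies in the region \<open>\<Omega>\<close>, the pair of functions \<open>(u,v)\<close> satisfies the first system exactly
  when \<open>\<Phi>(x,u,v)\<close> satisfies the second one. The condition is imposed at each point \<open>x\<close>
  separately, so that it applies to solutions on every subdomain of \<open>S\<close>.
\<close>

definition corresponds ::
    "complex set \<Rightarrow> (complex \<times> complex) set \<Rightarrow> (complex \<Rightarrow> complex \<times> complex \<Rightarrow> complex \<times> complex)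
       \<Rightarrow> ode_system \<Rightarrow> ode_system \<Rightarrow> bool" where
  "corresponds S \<Omega> \<Phi> F G \<longleftrightarrow>
     (\<forall>x\<in>S. \<forall>u v. (u x, v x) \<in> \<Omega> \<longrightarrow>
        (satisfies_at F x u v \<longleftrightarrow>
         satisfies_at G x (\<lambda>t. fst (\<Phi> t (u t, v t))) (\<lambda>t. snd (\<Phi> t (u t, v t)))))"

definition blow_up ::
    "complex \<Rightarrow> complex \<Rightarrow> (complex \<Rightarrow> complex) \<Rightarrow> complex \<Rightarrow> complex \<times> complex \<Rightarrow> complex \<times> complex" where
  "blow_up a1 a2 q x = (\<lambda>(U, V). (a1 * U * V + q x, a2 * V + deriv q x))"

definition chart_change :: "complex \<times> complex \<Rightarrow> complex \<times> complex" where
  "chart_change = (\<lambda>(U, V). (1 / U, U * V))"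

text \<open>
  \<open>G\<close> is obtained from system V by the blow-up, which gives a system \<open>F\<close> for \<open>(U,V)\<close>, followed by
  \<open>(U,V) \<mapsto> (y,z) = (1/U, UV)\<close>. The blow-up is invertible only off the exceptional line \<open>V = 0\<close>,
  and the second substitution lives on \<open>U \<noteq> 0\<close> and reaches only \<open>y \<noteq> 0\<close>; on the remaining lines
  \<open>V = 0\<close> and \<open>y = 0\<close> the systems \<open>F\<close> and \<open>G\<close> are the continuous extensions.
\<close>

definition modified_IXB2 ::
    "complex set \<Rightarrow> complex \<Rightarrow> complex \<Rightarrow> (complex \<Rightarrow> complex) \<Rightarrow> ode_system \<Rightarrow> bool" where
  "modified_IXB2 S a1 a2 q G \<longleftrightarrow>
     (\<exists>F. (\<forall>x\<in>S. continuous_on UNIV (F x)) \<and>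
          corresponds S {(U, V). V \<noteq> 0} (blow_up a1 a2 q) F system_V \<and>
          corresponds S {(U, V). U \<noteq> 0} (\<lambda>x. chart_change) F G) \<and>
     (\<forall>x\<in>S. continuous_on UNIV (G x))"

end

theory Submission
  imports Defs
begin

text \<open>
  Off \<open>V = 0\<close>, respectively \<open>U = 0\<close>, both substitutions are invertible up to differentiability at a
  point, so the correspondences amount to computations with the product rule. Conversely, affine
  functions \<open>u\<close>, \<open>v\<close> realise every prescribed value and derivative at a point; hence each
  correspondence determines its systems on \<open>\<Omega>\<close> and on the image of \<open>\<Omega>\<close>, and continuity
  determines them on the complementary lines.
\<close>

text \<open>The blow-up solved for the derivatives: V' = 6(y^2 - q^2)/a2 with y - q = a1 U V, and
  (UV)' = (a2/a1) V gives U' = a2/a1 - U V'/V. Since V divides V', the result is polynomial in U, V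
  and so extends to V = 0.\<close>

definition blown_up_system :: "complex \<Rightarrow> complex \<Rightarrow> (complex \<Rightarrow> complex) \<Rightarrow> ode_system" where
  "blown_up_system a1 a2 q x = (\<lambda>(U, V).
     (a2 / a1 - (6 * a1\<^sup>2 * U^3 * V + 12 * a1 * U\<^sup>2 * q x) / a2,
      (6 * a1\<^sup>2 * U\<^sup>2 * V\<^sup>2 + 12 * a1 * U * V * q x) / a2))"

definition IXB2m_system :: "complex \<Rightarrow> complex \<Rightarrow> (complex \<Rightarrow> complex) \<Rightarrow> ode_system" where
  "IXB2m_system a1 a2 q x = (\<lambda>(y, z).
     (- (a2 / a1) * y\<^sup>2 + 6 * (a1 / a2) * (a1 * z + 2 * q x), (a2 / a1) * y * z))"

text \<open>Differentiability of \<open>u\<close> is a conclusion here: \<open>v\<close> is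
  continuous and nonzero at \<open>x\<close>, hence nonzero nearby, where \<open>u\<close> is the
  quotient of the product by \<open>v\<close>. This inverts substitutions in which one factor is
  known only through a product.\<close>

lemma has_field_derivative_cancel_right:
  fixes u v :: "'a::real_normed_field \<Rightarrow> 'a"
  assumes uv: "((\<lambda>t. u t * v t) has_field_derivative d) (at x)"
    and v: "(v has_field_derivative dv) (at x)" and nz: "v x \<noteq> 0"
  shows "(u has_field_derivative (d - u x * dv) / v x) (at x)"
proof -
  have "\<forall>\<^sub>F t in nhds x. v t \<noteq> 0"
    using DERIV_isCont[OF v] nz unfolding isCont_def
    by (metis t1_space_nhds tendsto_imp_eventually_ne eventually_nhds_conv_at)
  then have ev: "\<forall>\<^sub>F t in nhds x. u t * v t / v t = u t"
    by eventually_elim simp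
  have "((\<lambda>t. u t * v t / v t) has_field_derivative (d - u x * dv) / v x) (at x)"
    using DERIV_divide[OF uv v nz] by (rule DERIV_cong) (use nz in \<open>simp add: field_simps\<close>)
  then show ?thesis
    using DERIV_cong_ev[OF refl ev refl] by blast
qed

lemma corresponds_cong:
  assumes "\<And>x. x \<in> S \<Longrightarrow> F x = F' x" "\<And>x. x \<in> S \<Longrightarrow> G x = G' x"
  shows "corresponds S \<Omega> \<Phi> F G \<longleftrightarrow> corresponds S \<Omega> \<Phi> F' G'"
  using assms by (simp add: corresponds_def satisfies_at_def)

lemma correspondsD:
  assumes "corresponds S \<Omega> \<Phi> F G" "x \<in> S" "(u x, v x) \<in> \<Omega>"
  shows "satisfies_at F x u v \<longleftrightarrow>
    satisfies_at G x (\<lambda>t. fst (\<Phi> t (u t, v t))) (\<lambda>t. snd (\<Phi> t (u t, v t)))"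
  using assms unfolding corresponds_def by blast

text \<open>\<open>satisfies_at\<close> constrains only values and first derivatives at one point,
  so affine functions through \<open>p\<close> with slopes \<open>F x p\<close> serve as test
  solutions.\<close>

lemma satisfies_at_affine:
  "satisfies_at F x (\<lambda>t. fst p + fst (F x p) * (t - x)) (\<lambda>t. snd p + snd (F x p) * (t - x))"
  unfolding satisfies_at_def by (auto intro!: derivative_eq_intros)

lemma satisfies_at_unique:
  assumes "satisfies_at F x u v" "satisfies_at F' x u v"
  shows "F x (u x, v x) = F' x (u x, v x)"
  using assms unfolding satisfies_at_def by (meson DERIV_unique prod_eqI)

text \<open>The test solution of \<open>F\<close> through \<open>p\<close> is carried to
  \<open>G\<close> and back to \<open>F'\<close>; its derivative at \<open>x\<close> is then both
  \<open>F x p\<close> and \<open>F' x p\<close>.\<close>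

lemma corresponds_source_unique:
  assumes "corresponds S \<Omega> \<Phi> F G" "corresponds S \<Omega> \<Phi> F' G" "x \<in> S" "p \<in> \<Omega>"
  shows "F x p = F' x p"
proof -
  let ?u = "\<lambda>t. fst p + fst (F x p) * (t - x)" and ?v = "\<lambda>t. snd p + snd (F x p) * (t - x)"
  have sat: "satisfies_at F x ?u ?v" by (rule satisfies_at_affine)
  have \<Omega>: "(?u x, ?v x) \<in> \<Omega>" using assms(4) by simp
  have "satisfies_at F' x ?u ?v"
    using sat correspondsD[where u = ?u and v = ?v, OF assms(1,3) \<Omega>]
      correspondsD[where u = ?u and v = ?v, OF assms(2,3) \<Omega>] by simp
  from satisfies_at_unique[OF sat this] show ?thesis by simp
qed

text \<open>The image of one test solution of \<open>F\<close> satisfies both \<open>G\<close> and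
  \<open>G'\<close> at the point \<open>\<Phi> x p\<close>, so agreement is obtained on the image of
  \<open>\<Omega>\<close>.\<close>

lemma corresponds_target_unique:
  assumes "corresponds S \<Omega> \<Phi> F G" "corresponds S \<Omega> \<Phi> F G'" "x \<in> S" "p \<in> \<Omega>"
  shows "G x (\<Phi> x p) = G' x (\<Phi> x p)"
proof -
  let ?u = "\<lambda>t. fst p + fst (F x p) * (t - x)" and ?v = "\<lambda>t. snd p + snd (F x p) * (t - x)"
  let ?y = "\<lambda>t. fst (\<Phi> t (?u t, ?v t))" and ?z = "\<lambda>t. snd (\<Phi> t (?u t, ?v t))"
  have sat: "satisfies_at F x ?u ?v" by (rule satisfies_at_affine)
  have \<Omega>: "(?u x, ?v x) \<in> \<Omega>" using assms(4) by simp
  have "satisfies_at G x ?y ?z"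
    using sat correspondsD[where u = ?u and v = ?v, OF assms(1,3) \<Omega>] by simp
  moreover have "satisfies_at G' x ?y ?z"
    using sat correspondsD[where u = ?u and v = ?v, OF assms(2,3) \<Omega>] by simp
  ultimately show ?thesis by (auto dest: satisfies_at_unique)
qed

lemma continuous_eq_if_eq_on_dense:
  fixes f g :: "'a::topological_space \<Rightarrow> 'b::t2_space"
  assumes "continuous_on UNIV f" "continuous_on UNIV g" "closure A = UNIV"
    and "\<And>x. x \<in> A \<Longrightarrow> f x = g x"
  shows "f = g"
proof -
  have "closure A \<subseteq> {x. f x = g x}"
    using assms by (intro closure_minimal closed_Collect_eq) auto
  then show ?thesis using assms(3) by auto
qed

lemma closure_nonzero: "closure (- {0 :: complex}) = UNIV"
  by (simp add: closure_complement)

lemma closure_fst_nonzero: "closure {(U, V :: complex). U \<noteq> (0 :: complex)} = UNIV"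
proof -
  have "{(U, V :: complex). U \<noteq> (0 :: complex)} = (- {0}) \<times> UNIV" by auto
  then show ?thesis by (simp add: closure_Times closure_nonzero)
qed

lemma closure_snd_nonzero: "closure {(U :: complex, V). V \<noteq> (0 :: complex)} = UNIV"
proof -
  have "{(U :: complex, V). V \<noteq> (0 :: complex)} = UNIV \<times> (- {0})" by auto
  then show ?thesis by (simp add: closure_Times closure_nonzero)
qed

lemma continuous_blown_up_system: "continuous_on UNIV (blown_up_system a1 a2 q x)"
  \<comment> \<open>Division by \<open>a2\<close> becomes multiplication by a constant, which leaves
    no side condition that \<open>a2\<close> be nonzero.\<close>
  unfolding blown_up_system_def case_prod_unfold divide_inverse
  by (intro continuous_intros)

lemma continuous_IXB2m_system: "continuous_on UNIV (IXB2m_system a1 a2 q x)"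
  unfolding IXB2m_system_def case_prod_unfold by (intro continuous_intros)

lemma corresponds_blow_up:
  assumes "open S" and nz: "a1 \<noteq> 0" "a2 \<noteq> 0" and q: "PI_transcendent_on S q"
  shows "corresponds S {(U, V). V \<noteq> 0} (blow_up a1 a2 q) (blown_up_system a1 a2 q) system_V"
  unfolding corresponds_def
proof (intro ballI allI impI)
  fix x and u v :: "complex \<Rightarrow> complex"
  assume x: "x \<in> S" and "(u x, v x) \<in> {(U, V). V \<noteq> (0 :: complex)}"
  then have v0: "v x \<noteq> 0" by simp
  have hol: "q holomorphic_on S" using q by (simp add: PI_transcendent_on_def)
  have dq: "(q has_field_derivative deriv q x) (at x)"
    by (rule holomorphic_derivI[OF hol \<open>open S\<close> x])
  have ddq: "(deriv q has_field_derivative 6 * (q x)\<^sup>2 + x) (at x)"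
    using holomorphic_derivI[OF holomorphic_deriv[OF hol \<open>open S\<close>] \<open>open S\<close> x] q x
    by (simp add: PI_transcendent_on_def)
  define y z where "y = (\<lambda>t. a1 * u t * v t + q t)" and "z = (\<lambda>t. a2 * v t + deriv q t)"
  define dU where "dU = a2 / a1 - (6 * a1\<^sup>2 * u x^3 * v x + 12 * a1 * (u x)\<^sup>2 * q x) / a2"
  define dV where "dV = (6 * a1\<^sup>2 * (u x)\<^sup>2 * (v x)\<^sup>2 + 12 * a1 * u x * v x * q x) / a2"
  \<comment> \<open>The algebraic core: the first identity is y' = z after q' cancels, the second is
    z' = 6 y^2 + x, with the Painleve equation supplying q''.\<close>
  have uv': "dU * v x + u x * dV = a2 / a1 * v x"
    using nz by (simp add: dU_def dV_def field_simps power2_eq_square power3_eq_cube)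
  have v': "a2 * dV + (6 * (q x)\<^sup>2 + x) = 6 * (y x)\<^sup>2 + x"
    using nz by (simp add: dV_def y_def power2_eq_square field_simps)
  have "(u has_field_derivative dU) (at x) \<and> (v has_field_derivative dV) (at x) \<longleftrightarrow>
        (y has_field_derivative z x) (at x) \<and> (z has_field_derivative 6 * (y x)\<^sup>2 + x) (at x)"
  proof safe
    assume u: "(u has_field_derivative dU) (at x)" and v: "(v has_field_derivative dV) (at x)"
    have "((\<lambda>t. a1 * (u t * v t) + q t) has_field_derivative
        a1 * (dU * v x + dV * u x) + deriv q x) (at x)"
      by (intro DERIV_add DERIV_cmult DERIV_mult u v dq)
    moreover have "a1 * (dU * v x + dV * u x) + deriv q x = z x"
      using uv' nz by (simp add: z_def mult.commute[of dV])
    ultimately show "(y has_field_derivative z x) (at x)"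
      by (simp add: y_def mult.assoc)
    have "(z has_field_derivative a2 * dV + (6 * (q x)\<^sup>2 + x)) (at x)"
      unfolding z_def by (intro DERIV_add DERIV_cmult v ddq)
    then show "(z has_field_derivative 6 * (y x)\<^sup>2 + x) (at x)"
      by (simp only: v')
  next
    assume y: "(y has_field_derivative z x) (at x)"
      and z: "(z has_field_derivative 6 * (y x)\<^sup>2 + x) (at x)"
    \<comment> \<open>Inverting the blow-up: V and the product UV are affine in z - q' and y - q,
      hence differentiable; U then follows by cancelling V \<noteq> 0.\<close>
    have "((\<lambda>t. (z t - deriv q t) / a2) has_field_derivative
        (6 * (y x)\<^sup>2 + x - (6 * (q x)\<^sup>2 + x)) / a2) (at x)"
      by (intro DERIV_cdivide DERIV_diff z ddq)
    also have "(\<lambda>t. (z t - deriv q t) / a2) = v" using nz by (simp add: z_def)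
    also have "(6 * (y x)\<^sup>2 + x - (6 * (q x)\<^sup>2 + x)) / a2 = dV"
      using nz by (simp add: v'[symmetric])
    finally show v: "(v has_field_derivative dV) (at x)" .
    have "((\<lambda>t. (y t - q t) / a1) has_field_derivative (z x - deriv q x) / a1) (at x)"
      by (intro DERIV_cdivide DERIV_diff y dq)
    also have "(\<lambda>t. (y t - q t) / a1) = (\<lambda>t. u t * v t)" using nz by (simp add: y_def)
    also have "(z x - deriv q x) / a1 = dU * v x + u x * dV" unfolding uv' by (simp add: z_def)
    finally show "(u has_field_derivative dU) (at x)"
      using has_field_derivative_cancel_right[OF _ v v0] v0 by fastforce
  qed
  then show "satisfies_at (blown_up_system a1 a2 q) x u v \<longleftrightarrow>
      satisfies_at system_V x (\<lambda>t. fst (blow_up a1 a2 q t (u t, v t)))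
        (\<lambda>t. snd (blow_up a1 a2 q t (u t, v t)))"
    by (simp add: satisfies_at_def blown_up_system_def system_V_def blow_up_def
        y_def z_def dU_def dV_def)
qed

text \<open>In y' = -U'/U^2 the division by U^2 leaves 1/U^2 = y^2 and a term linear in UV = z; and
  z' = (UV)' = (a2/a1) V, where V = yz.\<close>

lemma corresponds_chart_change:
  assumes nz: "a1 \<noteq> 0" "a2 \<noteq> 0"
  shows "corresponds S {(U, V). U \<noteq> 0} (\<lambda>x. chart_change)
    (blown_up_system a1 a2 q) (IXB2m_system a1 a2 q)"
  unfolding corresponds_def
proof (intro ballI allI impI)
  fix x and u v :: "complex \<Rightarrow> complex"
  assume "(u x, v x) \<in> {(U, V). U \<noteq> (0 :: complex)}"
  then have u0: "u x \<noteq> 0" by simp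
  define dU where "dU = a2 / a1 - (6 * a1\<^sup>2 * u x^3 * v x + 12 * a1 * (u x)\<^sup>2 * q x) / a2"
  define dV where "dV = (6 * a1\<^sup>2 * (u x)\<^sup>2 * (v x)\<^sup>2 + 12 * a1 * u x * v x * q x) / a2"
  define dy where "dy = - (a2 / a1) * (1 / u x)\<^sup>2 + 6 * (a1 / a2) * (a1 * (u x * v x) + 2 * q x)"
  define dz where "dz = (a2 / a1) * (1 / u x) * (u x * v x)"
  have dy: "dy = - dU / (u x)\<^sup>2"
    using nz u0 by (simp add: dU_def dy_def field_simps power2_eq_square power3_eq_cube)
  have dz: "dz = dV * u x + v x * dU"
    using nz u0 by (simp add: dU_def dV_def dz_def field_simps power2_eq_square power3_eq_cube)
  have "(u has_field_derivative dU) (at x) \<and> (v has_field_derivative dV) (at x) \<longleftrightarrow>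
      ((\<lambda>t. 1 / u t) has_field_derivative dy) (at x) \<and>
      ((\<lambda>t. u t * v t) has_field_derivative dz) (at x)"
  proof safe
    assume u: "(u has_field_derivative dU) (at x)" and v: "(v has_field_derivative dV) (at x)"
    show "((\<lambda>t. 1 / u t) has_field_derivative dy) (at x)"
      using u0 by (auto intro!: derivative_eq_intros u simp: dy power2_eq_square)
    show "((\<lambda>t. u t * v t) has_field_derivative dz) (at x)"
      by (auto intro!: derivative_eq_intros u v simp: dz)
  next
    assume y: "((\<lambda>t. 1 / u t) has_field_derivative dy) (at x)"
      and z: "((\<lambda>t. u t * v t) has_field_derivative dz) (at x)"
    \<comment> \<open>As 1/0 = 0, the function \<open>1 / (1 / u t)\<close> equals
      \<open>u t\<close> for every \<open>t\<close>, even at zeros of \<open>u\<close>.\<close>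
    have "((\<lambda>t. 1 / (1 / u t)) has_field_derivative
        (0 * (1 / u x) - 1 * dy) / (1 / u x * (1 / u x))) (at x)"
      using u0 by (intro DERIV_divide DERIV_const y) simp
    then show u: "(u has_field_derivative dU) (at x)"
      using u0 by (simp add: dy power2_eq_square)
    have "((\<lambda>t. v t * u t) has_field_derivative dV * u x + v x * dU) (at x)"
      using z by (simp add: dz mult.commute[of "v _" "u _"])
    from has_field_derivative_cancel_right[OF this u u0]
    show "(v has_field_derivative dV) (at x)" using u0 by simp
  qed
  then show "satisfies_at (blown_up_system a1 a2 q) x u v \<longleftrightarrow>
      satisfies_at (IXB2m_system a1 a2 q) x (\<lambda>t. fst (chart_change (u t, v t)))
        (\<lambda>t. snd (chart_change (u t, v t)))"
    by (simp add: satisfies_at_def blown_up_system_def IXB2m_system_def chart_change_def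
        dU_def dV_def dy_def dz_def)
qed

theorem proposition2p1:
  fixes S :: "complex set" and a1 a2 :: complex and q :: "complex \<Rightarrow> complex"
    and G :: ode_system
  assumes "open S"
    and "a1 \<noteq> 0" and "a2 \<noteq> 0"
    and "PI_transcendent_on S q"
  shows "modified_IXB2 S a1 a2 q G \<longleftrightarrow>
    (\<forall>x\<in>S. \<forall>y z. G x (y, z) =
       (- (a2 / a1) * y\<^sup>2 + 6 * (a1 / a2) * (a1 * z + 2 * q x),
        (a2 / a1) * y * z))"
proof -
  let ?F = "blown_up_system a1 a2 q" and ?G = "IXB2m_system a1 a2 q"
  note blow = corresponds_blow_up[OF assms]
  note chart = corresponds_chart_change[OF assms(2,3)]
  have "modified_IXB2 S a1 a2 q G \<longleftrightarrow> (\<forall>x\<in>S. G x = ?G x)"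
  proof
    assume "modified_IXB2 S a1 a2 q G"
    then obtain F where contF: "\<And>x. x \<in> S \<Longrightarrow> continuous_on UNIV (F x)"
      and F: "corresponds S {(U, V). V \<noteq> 0} (blow_up a1 a2 q) F system_V"
      and FG: "corresponds S {(U, V). U \<noteq> 0} (\<lambda>x. chart_change) F G"
      and contG: "\<And>x. x \<in> S \<Longrightarrow> continuous_on UNIV (G x)"
      unfolding modified_IXB2_def by blast
    \<comment> \<open>\<open>F\<close> is identified on the whole plane first, since the region U
      \<noteq> 0 of the second correspondence contains points with V = 0.\<close>
    have "F x = ?F x" if "x \<in> S" for x
      using contF[OF that] continuous_blown_up_system closure_snd_nonzero
        corresponds_source_unique[OF F blow that]
      by (rule continuous_eq_if_eq_on_dense)
    then have FG': "corresponds S {(U, V). U \<noteq> 0} (\<lambda>x. chart_change) ?F G"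
      using FG corresponds_cong by blast
    show "\<forall>x\<in>S. G x = ?G x"
    proof
      fix x assume x: "x \<in> S"
      show "G x = ?G x"
        using contG[OF x] continuous_IXB2m_system closure_fst_nonzero
      proof (rule continuous_eq_if_eq_on_dense)
        fix p :: "complex \<times> complex"
        assume p: "p \<in> {(U, V). U \<noteq> 0}"
        \<comment> \<open>The chart change is an involution of the pairs with nonzero first entry,
          so \<open>chart_change p\<close> is a preimage of \<open>p\<close>. The set written with U
          is here the image y \<noteq> 0.\<close>
        have p': "chart_change (1 / fst p, fst p * snd p) = p"
          and "(1 / fst p, fst p * snd p) \<in> {(U, V). U \<noteq> 0}"
          using p by (auto simp: chart_change_def)
        from corresponds_target_unique[OF FG' chart x this(2)]
        show "G x p = ?G x p" by (simp only: p')
      qed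
    qed
  next
    \<comment> \<open>The intermediate system is witnessed by \<open>?F\<close>; both
      correspondences depend on \<open>G\<close> only through \<open>G x\<close> with
      \<open>x\<close> in \<open>S\<close>.\<close>
    assume G: "\<forall>x\<in>S. G x = ?G x"
    then have "corresponds S {(U, V). U \<noteq> 0} (\<lambda>x. chart_change) ?F G"
      using chart corresponds_cong by blast
    then show "modified_IXB2 S a1 a2 q G"
      unfolding modified_IXB2_def
      using blow continuous_blown_up_system continuous_IXB2m_system G by fastforce
  qed
  also have "\<dots> \<longleftrightarrow> (\<forall>x\<in>S. \<forall>y z. G x (y, z) =
       (- (a2 / a1) * y\<^sup>2 + 6 * (a1 / a2) * (a1 * z + 2 * q x),
        (a2 / a1) * y * z))"
    by (simp add: fun_eq_iff IXB2m_system_def)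
  finally show ?thesis .
qed

end
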